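(* Let $a>0$ and $k\in\mathbb{R}$, let $L_k$ be the linear functional determined by $$L_k[D_{n,k}D_{m,k}]=h_n(k)\,\delta_{n,m},\quad n,m\in\mathbb{N}_0,\qquad h_0(k)=2-k,\quad h_n(k)=a^n\ (n\ge1),$$ and let $\mu_{2n}(k)=L_k[x^{2n}]$ be its moments of even order. Then $$\mu_{2n}(1)=2^{2n+1}\binom{\frac12}{n+1}(-a)^n,\quad n=0,1,2,\dots,$$ $$\mu_{2n}(2)=-2^{2n-1}\binom{\frac12}{n}(-a)^n,\quad n=1,2,\dots,$$ and, if $k\neq1,2$, for $n=0,1,2,\dots$, $$\mu_{2n}(k)=-\frac12\,\frac{(k-2)^{2n}}{(k-1)^{n+1}}(-a)^n\left(\frac{k}{k-2}+\sum_{j=0}^{n}\binom{\frac12}{j}\left[\frac{4(k-1)}{(k-2)^2}\right]^j\right).$$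
   Context: $\mathbb{N}_0=\{0,1,2,\dots\}$, $\delta_{n,m}$ is Kronecker's delta, and $\binom{1/2}{j}=\frac{1}{j!}\prod_{i=0}^{j-1}(\tfrac12-i)$. For $a>0$, $k\in\mathbb{R}$, the Dickson polynomials of the $(k+1)$-th kind $D_{n,k}(x)=D_{n,k}(x;a)$ are defined by $D_{0,k}(x;a)=2-k$ and, for $n\ge1$, $$D_{n,k}(x;a)=\sum_{j=0}^{\lfloor n/2\rfloor}\frac{n-kj}{n-j}\binom{n-j}{j}(-a)^jx^{n-2j};$$ equivalently $D_{0,k}=2-k$, $D_{1,k}=x$, $D_{n+2,k}=xD_{n+1,k}-aD_{n,k}$. For $k\neq2$, $L_k$ is a linear functional on $\mathbb{C}[x]$, uniquely determined by the stated relations. For $k=2$ one has $D_{0,2}=0$ and every $D_{n,2}$, $n\ge1$, is divisible by $x$; then $L_2$ is understood as the linear functional on $x^2\mathbb{C}[x]$ determined by the stated relations (the paper's interpretation), namely $L_2[x^2p(x)]=\frac{1}{2\pi}\int_{-2\sqrt a}^{2\sqrt a}p(t)\sqrt{4a-t^2}\,dt$. *)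

theory Defs
  imports Complex_Main "HOL-Computational_Algebra.Polynomial"
begin

definition dickson :: "real \<Rightarrow> real \<Rightarrow> nat \<Rightarrow> complex poly" where
  "dickson a k n =
     (if n = 0 then [:of_real (2 - k):]
      else \<Sum>j\<le>n div 2.
             monom (of_real ((real n - k * real j) / real (n - j) * real ((n - j) choose j) * (- a) ^ j))
                   (n - 2 * j))"

definition dickson_norm :: "real \<Rightarrow> real \<Rightarrow> nat \<Rightarrow> real" where
  "dickson_norm a k n = (if n = 0 then 2 - k else a ^ n)"

text \<open>For \<open>k = 2\<close> the polynomials are all divisible by \<open>x\<close> (and the one of index 0 vanishes), so the
  orthogonality relations determine the functional only on the multiples of \<open>x\<^sup>2\<close>; it is then a
  functional on that subspace, and its values elsewhere are irrelevant.\<close>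

definition dickson_domain :: "real \<Rightarrow> complex poly set" where
  "dickson_domain k = (if k = 2 then {p. monom 1 2 dvd p} else UNIV)"

definition linear_functional_on :: "complex poly set \<Rightarrow> (complex poly \<Rightarrow> complex) \<Rightarrow> bool" where
  "linear_functional_on V L \<longleftrightarrow>
     (\<forall>p\<in>V. \<forall>q\<in>V. L (p + q) = L p + L q) \<and> (\<forall>c. \<forall>p\<in>V. L (smult c p) = c * L p)"

definition dickson_functional :: "real \<Rightarrow> real \<Rightarrow> (complex poly \<Rightarrow> complex) \<Rightarrow> bool" where
  "dickson_functional a k L \<longleftrightarrow>
     linear_functional_on (dickson_domain k) L \<and>
     (\<forall>n m. L (dickson a k n * dickson a k m) = (if n = m then of_real (dickson_norm a k n) else 0))"

definition moment :: "(complex poly \<Rightarrow> complex) \<Rightarrow> nat \<Rightarrow> complex" where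
  "moment L n = L (monom 1 n)"

text \<open>The definitions below serve only to prove that such a functional exists, and that for \<open>a > 0\<close> it is
  unique on its domain.\<close>

definition dcoeff :: "real \<Rightarrow> nat \<Rightarrow> nat \<Rightarrow> real" where
  "dcoeff k n j = (if 2 * j \<le> n then if n = 0 then 2 - k else (real n - k * real j) / real (n - j) * real ((n - j) choose j) else 0)"

lemma coeff_dickson:
  "coeff (dickson a k n) i = (if i \<le> n \<and> even (n - i) then of_real (dcoeff k n ((n - i) div 2) * (- a) ^ ((n - i) div 2)) else 0)"
proof (cases "n = 0")
  case True then show ?thesis by (cases i) (auto simp: dickson_def dcoeff_def)
next
  case False
  have "coeff (dickson a k n) i = (\<Sum>j\<le>n div 2. if n - 2 * j = i then of_real (dcoeff k n j * (- a) ^ j) else 0)"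
    using False by (auto simp: dickson_def dcoeff_def coeff_sum intro!: sum.cong)
  also have "\<dots> = (\<Sum>j\<le>n div 2. if j = (n - i) div 2 then if i \<le> n \<and> even (n - i) then of_real (dcoeff k n j * (- a) ^ j) else 0 else 0)"
  proof (intro sum.cong refl)
    fix j assume "j \<in> {..n div 2}"
    then have "n - 2 * j = i \<longleftrightarrow> j = (n - i) div 2 \<and> i \<le> n \<and> even (n - i)"
      by (auto elim!: evenE) presburger+
    then show "(if n - 2 * j = i then of_real (dcoeff k n j * (- a) ^ j) else 0) = (if j = (n - i) div 2 then if i \<le> n \<and> even (n - i) then of_real (dcoeff k n j * (- a) ^ j) else (0::complex) else 0)"
      by simp
  qed
  also have "\<dots> = (if i \<le> n \<and> even (n - i) then of_real (dcoeff k n ((n - i) div 2) * (- a) ^ ((n - i) div 2)) else 0)"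
    by (simp add: sum.delta div_le_mono)
  finally show ?thesis .
qed

lemma dcoeff_aux:
  assumes "i \<le> Suc r"
  shows "dcoeff k (Suc r + Suc i) (Suc i) = real (Suc r choose Suc i) - (k - 1) * real (r choose i)"
proof (cases "i = Suc r")
  case True then show ?thesis by (simp add: dcoeff_def binomial_eq_0)
next
  case False
  define C where "C = real (Suc r choose Suc i)"
  have "real (Suc i) * C = real (Suc r) * real (r choose i)"
    unfolding C_def by (metis Suc_times_binomial of_nat_mult)
  then have e: "real (r choose i) = real (Suc i) * C / real (Suc r)"
    by (simp add: field_simps)
  have "dcoeff k (Suc r + Suc i) (Suc i) = (real (Suc r) + real (Suc i) - k * real (Suc i)) / real (Suc r) * C"
    using assms False by (simp add: dcoeff_def C_def del: binomial_Suc_Suc)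
  also have "\<dots> = C - (k - 1) * real (r choose i)"
    unfolding e by (simp add: divide_simps) (simp add: algebra_simps)
  finally show ?thesis by (simp add: C_def)
qed

lemma dcoeff_0: "dcoeff k (Suc n) 0 = 1" by (simp add: dcoeff_def)

lemma dcoeff_00: "dcoeff k 0 0 = 2 - k" by (simp add: dcoeff_def)

lemma dcoeff_big: "2 * j > n \<Longrightarrow> dcoeff k n j = 0" by (simp add: dcoeff_def)

lemma dcoeff_rec:
  assumes "2 * j \<le> n"
  shows "dcoeff k (Suc (Suc n)) (Suc j) = dcoeff k (Suc n) (Suc j) + dcoeff k n j"
proof -
  obtain r where r: "n = r + j" using assms by (metis add.commute le_add2 le_trans mult_2 nat_le_iff_add)
  show ?thesis
  proof (cases j)
    case 0
    show ?thesis
    proof (cases r)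
      case 0 with \<open>j = 0\<close> r show ?thesis by (simp add: dcoeff_def)
    next
      case (Suc s) with \<open>j = 0\<close> r dcoeff_aux[of 0 "Suc s" k] dcoeff_aux[of 0 s k]
      show ?thesis by (simp add: dcoeff_0)
    qed
  next
    case (Suc i)
    then obtain s where s: "r = Suc s" using r assms by (cases r) auto
    have "i \<le> s" using assms r s Suc by simp
    then show ?thesis
      using r Suc s dcoeff_aux[of "Suc i" "Suc s" k] dcoeff_aux[of "Suc i" s k] dcoeff_aux[of i s k]
      by (simp add: algebra_simps)
  qed
qed

lemma dickson_Suc_Suc:
  "dickson a k (Suc (Suc n)) = pCons 0 (dickson a k (Suc n)) - smult (of_real a) (dickson a k n)"
proof (rule poly_eqI)
  fix i
  show "coeff (dickson a k (Suc (Suc n))) i = coeff (pCons 0 (dickson a k (Suc n)) - smult (of_real a) (dickson a k n)) i"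
  proof (cases "i \<le> n \<and> even (n - i)")
    case True
    then obtain j where j: "n = i + 2 * j" by (metis evenE le_add_diff_inverse)
    have e: "Suc (Suc n) - i = 2 * Suc j" "n - i = 2 * j" using j by auto
    have r: "dcoeff k (Suc (Suc n)) (Suc j) = dcoeff k (Suc n) (Suc j) + dcoeff k n j"
      by (rule dcoeff_rec) (simp add: j)
    show ?thesis
    proof (cases i)
      case 0
      have "dcoeff k (Suc n) (Suc j) = 0" by (rule dcoeff_big) (use 0 j in simp)
      then show ?thesis using r e j 0 by (simp add: coeff_dickson coeff_pCons)
    next
      case (Suc l)
      then have "Suc n - l = 2 * Suc j" using j by simp
      then show ?thesis using r e j Suc by (simp add: coeff_dickson coeff_pCons algebra_simps)
    qed
  next
    case False
    show ?thesis
    proof (cases "i = Suc (Suc n)")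
      case True then show ?thesis by (simp add: coeff_dickson dcoeff_0 coeff_pCons)
    next
      case ne: False
      have "\<not> (i \<le> Suc (Suc n) \<and> even (Suc (Suc n) - i))" using False ne
        by (cases "i \<le> n"; cases "i = Suc n") (auto simp: Suc_diff_le)
      moreover from this have "\<not> (i - 1 \<le> Suc n \<and> even (Suc n - (i - 1)))" if "i \<noteq> 0" using that by (cases i) auto
      ultimately show ?thesis using False by (auto simp: coeff_dickson coeff_pCons split: nat.split)
    qed
  qed
qed

lemma dickson_0: "dickson a k 0 = [:of_real (2 - k):]" by (simp add: dickson_def)

lemma dickson_1: "dickson a k (Suc 0) = monom 1 1" by (simp add: dickson_def)

lemma complex_of_real_eq_2_simps [simp]: "(2 - complex_of_real k = 0) = (k = 2)" "(complex_of_real k = 2) = (k = 2)" "(2 = complex_of_real k) = (k = 2)"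
  by (metis eq_iff_diff_eq_0 of_real_eq_iff of_real_numeral)+

text \<open>For \<open>k \<noteq> 2\<close>, \<open>dickson_coord a k p\<close> is the coordinate sequence of \<open>p\<close> in the basis
  \<open>dickson a k\<close>, and \<open>dickson_jacobi a k\<close> is multiplication by \<open>x\<close> in these coordinates. The
  functional is the coordinate of index 0.\<close>

fun dickson_jacobi :: "real \<Rightarrow> real \<Rightarrow> (nat \<Rightarrow> complex) \<Rightarrow> nat \<Rightarrow> complex" where
  "dickson_jacobi a k c 0 = of_real a * c 1"
| "dickson_jacobi a k c (Suc n) = (if n = 0 then of_real (2 - k) else 1) * c n + of_real a * c (n + 2)"

definition dickson_coord :: "real \<Rightarrow> real \<Rightarrow> complex poly \<Rightarrow> nat \<Rightarrow> complex" where
  "dickson_coord a k p = fold_coeffs (\<lambda>c u n. (if n = 0 then c / of_real (2 - k) else 0) + dickson_jacobi a k u n) p (\<lambda>_. 0)"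

lemma dickson_jacobi_0 [simp]: "dickson_jacobi a k (\<lambda>_. 0) = (\<lambda>_. 0)"
proof
  show "dickson_jacobi a k (\<lambda>_. 0) n = 0" for n by (cases n) auto
qed

lemma dickson_coord_0 [simp]: "dickson_coord a k 0 = (\<lambda>_. 0)" by (simp add: dickson_coord_def)

lemma dickson_coord_pCons: "dickson_coord a k (pCons c p) n = (if n = 0 then c / of_real (2 - k) else 0) + dickson_jacobi a k (dickson_coord a k p) n"
proof -
  have "(\<lambda>u n. (if n = 0 then 0 / of_real (2 - k) else 0) + dickson_jacobi a k u n) (\<lambda>_. 0) = (\<lambda>_. 0)"
    by (simp add: fun_eq_iff)
  then show ?thesis
    by (cases "c = 0 \<and> p = 0") (auto simp: dickson_coord_def fun_eq_iff)
qed

lemma dickson_coord_add: "dickson_coord a k (p + q) n = dickson_coord a k p n + dickson_coord a k q n"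
proof (induction p q arbitrary: n rule: poly_induct2)
  case (pCons c p d q)
  then show ?case by (cases n) (auto simp: dickson_coord_pCons algebra_simps add_divide_distrib)
qed simp

lemma dickson_coord_smult: "dickson_coord a k (smult c p) n = c * dickson_coord a k p n"
proof (induction p arbitrary: n)
  case (pCons d p)
  then show ?case by (cases n) (auto simp: dickson_coord_pCons algebra_simps)
qed simp

lemma dickson_coord_diff: "dickson_coord a k (p - q) n = dickson_coord a k p n - dickson_coord a k q n"
  using dickson_coord_add[of a k p "smult (-1) q" n] dickson_coord_smult[of a k "-1" q n] by simp

lemma dickson_coord_x_mult: "dickson_coord a k (pCons 0 p) n = dickson_jacobi a k (dickson_coord a k p) n"
  by (simp add: dickson_coord_pCons)

lemma dickson_coord_dickson:
  assumes "k \<noteq> 2" shows "dickson_coord a k (dickson a k n) m = (if m = n then 1 else 0)"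
proof (induction n arbitrary: m rule: induct_nat_012)
  case 0 show ?case using assms by (cases m) (auto simp: dickson_0 dickson_coord_pCons)
next
  case 1
  have "dickson a k (Suc 0) = pCons 0 [:1:]" by (simp add: dickson_1 monom_altdef)
  then show ?case using assms by (cases m) (auto simp: dickson_coord_pCons less_Suc_eq)
next
  case (ge2 n) then show ?case
    by (cases m) (auto simp: dickson_Suc_Suc dickson_coord_diff dickson_coord_smult dickson_coord_x_mult )
qed

lemma dickson_coord_mult:
  assumes "k \<noteq> 2" shows "dickson_coord a k (dickson a k n * p) 0 = of_real (dickson_norm a k n) * dickson_coord a k p n"
proof (induction n arbitrary: p rule: induct_nat_012)
  case 0 show ?case by (simp add: dickson_0 dickson_coord_smult dickson_norm_def)
next
  case 1
  have "dickson a k (Suc 0) * p = pCons 0 p" by (simp add: dickson_1 monom_altdef)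
  then show ?case by (auto simp: dickson_coord_pCons dickson_norm_def)
next
  case (ge2 n)
  have "dickson a k (Suc (Suc n)) * p = dickson a k (Suc n) * pCons 0 p - smult (of_real a) (dickson a k n * p)"
    by (simp add: dickson_Suc_Suc left_diff_distrib)
  then have "dickson_coord a k (dickson a k (Suc (Suc n)) * p) 0 =
      of_real (dickson_norm a k (Suc n)) * dickson_jacobi a k (dickson_coord a k p) (Suc n)
      - of_real a * (of_real (dickson_norm a k n) * dickson_coord a k p n)"
    by (simp only: dickson_coord_diff dickson_coord_smult ge2.IH dickson_coord_x_mult)
  then show ?case by (cases n) (auto simp: dickson_norm_def algebra_simps)
qed

lemma dickson_coord_orthogonal: assumes "k \<noteq> 2"
  shows "dickson_coord a k (dickson a k n * dickson a k m) 0 = (if n = m then of_real (dickson_norm a k n) else 0)"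
  using assms by (simp add: dickson_coord_mult dickson_coord_dickson)

lemma dickson_two: "dickson a 2 (Suc n) = pCons 0 (dickson a 1 n)"
proof (induction n rule: induct_nat_012)
qed (simp_all add: dickson_0 dickson_1 dickson_Suc_Suc monom_altdef)

lemma dickson_functional_exists: "\<exists>L. dickson_functional a k L"
proof (cases "k = 2")
  case False then show ?thesis
    by (intro exI[of _ "\<lambda>p. dickson_coord a k p 0"])
      (simp add: dickson_functional_def linear_functional_on_def dickson_coord_add dickson_coord_smult dickson_coord_orthogonal)
next
  case True
  define L where "L p = of_real a * dickson_coord a 1 (p div monom 1 2) 0" for p
  have dv: "pCons 0 p * pCons 0 q = monom 1 2 * (p * q)" for p q :: "complex poly"
    by (simp add: monom_altdef power2_eq_square)
  have "L (dickson a 2 n * dickson a 2 m) = (if n = m then of_real (dickson_norm a 2 n) else 0)" for n m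
  proof (cases "n = 0 \<or> m = 0")
    case True
    then show ?thesis by (auto simp: dickson_0 L_def dickson_norm_def)
  next
    case False
    then obtain n' m' where e: "n = Suc n'" "m = Suc m'" by (metis not0_implies_Suc)
    have "(monom 1 2 * (dickson a 1 n' * dickson a 1 m')) div monom 1 2 = dickson a 1 n' * dickson a 1 m'"
      by (rule nonzero_mult_div_cancel_left) simp
    then have "L (dickson a 2 n * dickson a 2 m) = of_real a * dickson_coord a 1 (dickson a 1 n' * dickson a 1 m') 0"
      by (simp only: e dickson_two dv L_def)
    then show ?thesis by (simp add: e dickson_coord_orthogonal dickson_norm_def)
  qed
  moreover have "linear_functional_on (dickson_domain 2) L"
    by (auto simp: linear_functional_on_def dickson_domain_def L_def dickson_coord_add dickson_coord_smult
         algebra_simps div_smult_left div_add elim!: dvdE)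
  ultimately show ?thesis using True by (auto simp: dickson_functional_def)
qed

lemma eq_dickson_coord_0:
  assumes add: "\<And>p q. L (p + q) = L p + L q" and sm: "\<And>c p. L (smult c p) = c * L p"
    and k: "k \<noteq> 2"
    and o: "\<And>n. L (dickson a k n) = (if n = 0 then l else 0)"
  shows "L p = l * dickson_coord a k p 0"
proof -
  have L0: "L 0 = 0" using sm[of 0 0] by simp
  have diff: "L (p - q) = L p - L q" for p q
    using add[of p "smult (-1) q"] sm[of "-1" q] by simp
  have "L (dickson a k n * p) = l * of_real (dickson_norm a k n) * dickson_coord a k p n" for n
  proof (induction p arbitrary: n)
    case 0 then show ?case by (simp add: L0)
  next
    case (pCons c p)
    have s: "dickson a k n * pCons c p = smult c (dickson a k n) + pCons 0 (dickson a k n) * p"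
      by simp
    have x0: "pCons 0 (dickson a k 0) = smult (of_real (2 - k)) (dickson a k 1)"
      by (simp add: dickson_0 dickson_1 monom_altdef)
    have x: "pCons 0 (dickson a k (Suc n)) = dickson a k (Suc (Suc n)) + smult (of_real a) (dickson a k n)" for n
      by (simp add: dickson_Suc_Suc)
    have "L (dickson a k n * pCons c p) = c * L (dickson a k n) + L (pCons 0 (dickson a k n) * p)"
      by (simp only: s add sm)
    also have "L (pCons 0 (dickson a k n) * p) = l * of_real (dickson_norm a k n) * dickson_jacobi a k (dickson_coord a k p) n"
    proof (cases n)
      case 0
      have "pCons 0 (dickson a k n) * p = smult (of_real (2 - k)) (dickson a k 1 * p)"
        unfolding 0 x0 by (rule mult_smult_left)
      then show ?thesis by (simp only: sm pCons.IH) (simp add: 0 dickson_norm_def)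
    next
      case (Suc m)
      have "pCons 0 (dickson a k n) * p = dickson a k (Suc (Suc m)) * p + smult (of_real a) (dickson a k m * p)"
        unfolding Suc x by (simp only: distrib_right mult_smult_left)
      then show ?thesis
        by (simp only: sm add pCons.IH) (cases m; simp add: Suc dickson_norm_def algebra_simps)
    qed
    also have "c * L (dickson a k n) =
        l * of_real (dickson_norm a k n) * (if n = 0 then c / of_real (2 - k) else 0)"
      using k by (simp add: o dickson_norm_def)
    finally show ?case by (simp only: dickson_coord_pCons distrib_left)
  qed
  from this[of 0] show ?thesis using k
    by (simp add: dickson_0 sm dickson_norm_def)
qed

lemma dickson_functional_unique:
  assumes "a > 0" "dickson_functional a k L" "dickson_functional a k M" "p \<in> dickson_domain k"
  shows "L p = M p"
proof (cases "k = 2")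
  case False
  have "L p = 1 * dickson_coord a k p 0" if "dickson_functional a k L" for L
  proof (rule eq_dickson_coord_0[OF _ _ False])
    have lin: "L (p + q) = L p + L q" "L (smult c p) = c * L p"
      and o: "L (dickson a k n * dickson a k m) =
        (if n = m then of_real (dickson_norm a k n) else 0)" for p q c n m
      using that False by (auto simp: dickson_functional_def linear_functional_on_def dickson_domain_def)
    show "L (p + q) = L p + L q" "L (smult c p) = c * L p" for p q c by (rule lin)+
    have e: "of_real (2 - k) * L (dickson a k n) = (if n = 0 then of_real (dickson_norm a k n) else 0)" for n
    proof -
      have "dickson a k n * dickson a k 0 = smult (of_real (2 - k)) (dickson a k n)"
        by (simp add: dickson_0)
      then show ?thesis using o[of n 0] by (simp only: lin)
    qed
    show "L (dickson a k n) = (if n = 0 then 1 else 0)" for n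
      using e[of n] False by (cases "n = 0") (simp_all add: dickson_norm_def)
  qed
  from this[OF assms(2)] this[OF assms(3)] show ?thesis by simp
next
  case True
  have *: "L (monom 1 2 * q) = of_real a * dickson_coord a 1 q 0" if "dickson_functional a k L" for L q
  proof (rule eq_dickson_coord_0[of "\<lambda>q. L (monom 1 2 * q)"])
    have lin: "L (monom 1 2 * p + monom 1 2 * q) = L (monom 1 2 * p) + L (monom 1 2 * q)"
       "L (smult c (monom 1 2 * p)) = c * L (monom 1 2 * p)"
      and o: "L (dickson a k n * dickson a k m) =
        (if n = m then of_real (dickson_norm a k n) else 0)" for p q c n m
      using that True by (auto simp: dickson_functional_def linear_functional_on_def dickson_domain_def)
    show "L (monom 1 2 * (p + q)) = L (monom 1 2 * p) + L (monom 1 2 * q)"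
       "L (monom 1 2 * (smult c p)) = c * L (monom 1 2 * p)" for p q c
      using lin by (simp_all add: distrib_left)
    have "dickson a k (Suc n) * dickson a k (Suc 0) = monom 1 2 * dickson a 1 n" for n
      by (simp add: True dickson_two dickson_0 monom_altdef power2_eq_square)
    then show "L (monom 1 2 * dickson a 1 n) = (if n = 0 then of_real a else 0)" for n
      using o[of "Suc n" "Suc 0"] by (simp add: dickson_norm_def)
  qed simp
  obtain q where "p = monom 1 2 * q" using assms True by (auto simp: dickson_domain_def)
  with *[OF assms(2)] *[OF assms(3)] show ?thesis by simp
qed

end

theory Submission
  imports Defs
begin

text \<open>The quadratic \<open>Q\<^sub>k = (k - 1) x\<^sup>2 + a (k - 2)\<^sup>2\<close> satisfies
  \<open>Q\<^sub>k D\<^sub>n\<^sub>,\<^sub>1 = (k - 1) D\<^sub>n\<^sub>+\<^sub>2\<^sub>,\<^sub>k + a D\<^sub>n\<^sub>,\<^sub>k\<close>, so for \<open>k \<noteq> 2\<close> the functional \<open>p \<mapsto> L\<^sub>k[Q\<^sub>k p]\<close> is \<open>a\<close> times \<open>L\<^sub>1\<close>.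
  For \<open>k = 2\<close> the same relation \<open>L\<^sub>2[x\<^sup>2 p] = a L\<^sub>1[p]\<close> comes from \<open>D\<^sub>n\<^sub>+\<^sub>1\<^sub>,\<^sub>2 = x D\<^sub>n\<^sub>,\<^sub>1\<close>. The moments of
  \<open>L\<^sub>1\<close> count weighted Dyck paths, hence are \<open>a\<^sup>n\<close> times Catalan numbers, and those of \<open>L\<^sub>k\<close> follow
  from the first-order recurrence \<open>(k - 1) \<mu>\<^sub>2\<^sub>n\<^sub>+\<^sub>2 + a (k - 2)\<^sup>2 \<mu>\<^sub>2\<^sub>n = a \<mu>\<^sub>2\<^sub>n(1)\<close>.\<close>

section \<open>Reduction of the functional to the case \<open>k = 1\<close>\<close>

definition dickson_quadratic :: "real \<Rightarrow> real \<Rightarrow> complex poly" where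
  "dickson_quadratic a k = [:of_real (a * (k - 2)\<^sup>2), 0, of_real (k - 1):]"

text \<open>Both sides obey the same three-term recurrence in \<open>n\<close>, so
  \<open>n = 0\<close> and \<open>n = 1\<close> suffice. The case \<open>n = 0\<close> dictates the
  quadratic, as D_{0,k} is the constant \<open>2 - k\<close>.\<close>

lemma dickson_quadratic_mult_dickson_1:
  "dickson_quadratic a k * dickson a 1 n =
     smult (of_real (k - 1)) (dickson a k (n + 2)) + smult (of_real a) (dickson a k n)"
proof (induction n rule: induct_nat_012)
  case 0
  show ?case
    by (simp add: dickson_quadratic_def dickson_0 dickson_1 dickson_Suc_Suc monom_altdef
        algebra_simps power2_eq_square)
next
  case 1
  show ?case
    by (simp add: dickson_quadratic_def dickson_0 dickson_1 dickson_Suc_Suc monom_altdef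
        algebra_simps power2_eq_square)
next
  case (ge2 n)
  have "dickson_quadratic a k * dickson a 1 (Suc (Suc n)) =
      pCons 0 (dickson_quadratic a k * dickson a 1 (Suc n))
      - smult (of_real a) (dickson_quadratic a k * dickson a 1 n)"
    by (simp add: dickson_Suc_Suc right_diff_distrib)
  also have "\<dots> = smult (of_real (k - 1)) (dickson a k (Suc (Suc n) + 2))
      + smult (of_real a) (dickson a k (Suc (Suc n)))"
  proof -
    have x: "pCons 0 (dickson a k (Suc m)) = dickson a k (Suc (Suc m)) + smult (of_real a) (dickson a k m)" for m
      by (simp add: dickson_Suc_Suc)
    have "pCons 0 (dickson_quadratic a k * dickson a 1 (Suc n)) =
        smult (of_real (k - 1)) (pCons 0 (dickson a k (Suc (n + 2))))
        + smult (of_real a) (pCons 0 (dickson a k (Suc n)))"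
      unfolding ge2.IH by simp
    then show ?thesis
      unfolding ge2.IH(1) x by (simp only: smult_add_right smult_smult mult.commute) simp
  qed
  finally show ?case .
qed

text \<open>This is orthogonality to D_{0,k}, a constant that can be divided out because it is
  nonzero.\<close>

lemma dickson_functional_dickson:
  assumes "dickson_functional a k L" "k \<noteq> 2"
  shows "L (dickson a k n) = (if n = 0 then 1 else 0)"
proof -
  have "of_real (2 - k) * L (dickson a k n) = L (dickson a k n * dickson a k 0)"
    using assms by (simp add: dickson_0 dickson_functional_def linear_functional_on_def dickson_domain_def)
  also have "\<dots> = (if n = 0 then of_real (2 - k) else 0)"
    using assms by (simp add: dickson_functional_def dickson_norm_def)
  finally show ?thesis using assms(2) by (cases "n = 0") simp_all
qed

text \<open>Testing on the basis D_{n,1} is enough. There the quadratic yields D_{n+2,k} and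
  D_{n,k}, and \<open>L\<close> kills both except D_{0,k}, which comes with the factor
  \<open>a\<close>.\<close>

lemma dickson_functional_quadratic_mult:
  assumes "dickson_functional a k L" "k \<noteq> 2"
  shows "L (dickson_quadratic a k * p) = of_real a * dickson_coord a 1 p 0"
proof (rule eq_dickson_coord_0)
  have lin: "L (p + q) = L p + L q" "L (smult c p) = c * L p" for p q c
    using assms by (auto simp: dickson_functional_def linear_functional_on_def dickson_domain_def)
  show "L (dickson_quadratic a k * (p + q)) = L (dickson_quadratic a k * p) + L (dickson_quadratic a k * q)"
    and "L (dickson_quadratic a k * smult c p) = c * L (dickson_quadratic a k * p)" for p q c
    by (simp_all only: distrib_left mult_smult_right lin)
  show "L (dickson_quadratic a k * dickson a 1 n) = (if n = 0 then of_real a else 0)" for n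
    by (simp add: dickson_quadratic_mult_dickson_1 lin dickson_functional_dickson[OF assms])
qed simp

text \<open>Here D_{0,2} = 0 carries no information, so D_{1,2} = x takes its place: x^2 D_{n,1} =
  D_{n+1,2} D_{1,2}, and the factor \<open>a\<close> is the norm of D_{1,2}.\<close>

lemma dickson_functional_2_mult:
  assumes "dickson_functional a 2 L"
  shows "L (monom 1 2 * p) = of_real a * dickson_coord a 1 p 0"
proof (rule eq_dickson_coord_0)
  have lin: "L (monom 1 2 * p + monom 1 2 * q) = L (monom 1 2 * p) + L (monom 1 2 * q)"
    "L (smult c (monom 1 2 * p)) = c * L (monom 1 2 * p)" for p q c
    using assms by (auto simp: dickson_functional_def linear_functional_on_def dickson_domain_def)
  show "L (monom 1 2 * (p + q)) = L (monom 1 2 * p) + L (monom 1 2 * q)"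
    and "L (monom 1 2 * smult c p) = c * L (monom 1 2 * p)" for p q c
    by (simp_all only: distrib_left mult_smult_right lin)
  have "monom 1 2 * dickson a 1 n = dickson a 2 (Suc n) * dickson a 2 (Suc 0)" for n
    by (simp add: dickson_two dickson_0 monom_altdef power2_eq_square)
  then show "L (monom 1 2 * dickson a 1 n) = (if n = 0 then of_real a else 0)" for n
    using assms by (simp add: dickson_functional_def dickson_norm_def)
qed simp

section \<open>Moments for \<open>k = 1\<close>: ballot paths and Catalan numbers\<close>

lemma dickson_coord_monom_Suc:
  "dickson_coord a k (monom 1 (Suc n)) = dickson_jacobi a k (dickson_coord a k (monom 1 n))"
  by (simp add: monom_Suc fun_eq_iff dickson_coord_x_mult)

text \<open>Multiplication by x raises the highest occupied index by at most one.\<close>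

lemma dickson_coord_monom_eq_0: "n < i \<Longrightarrow> dickson_coord a k (monom 1 n) i = 0"
proof (induction n arbitrary: i)
  case 0
  then show ?case by (cases i) (auto simp: monom_0 dickson_coord_pCons)
next
  case (Suc n)
  then show ?case by (cases i) (auto simp: dickson_coord_monom_Suc)
qed

text \<open>By the reflection principle this counts the paths from height 0 to height
  \<open>i\<close> that stay nonnegative and have \<open>j\<close> down-steps. The case split keeps
  truncated subtraction from turning the missing term at \<open>j = 0\<close> into 1.\<close>

definition ballot :: "nat \<Rightarrow> nat \<Rightarrow> real" where
  "ballot i j = real ((i + 2 * j) choose j) - (case j of 0 \<Rightarrow> 0 | Suc m \<Rightarrow> real ((i + 2 * j) choose m))"

lemma ballot_0_right: "ballot i 0 = 1"
  by (simp add: ballot_def)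

text \<open>A path ending at height 0 must arrive by a down-step from height 1.\<close>

lemma ballot_0_Suc: "ballot 0 (Suc j) = ballot 1 j"
proof -
  have "Suc (2 * j) choose Suc j = Suc (2 * j) choose j"
    by (subst binomial_symmetric) auto
  then show ?thesis
    by (cases j) (simp_all add: ballot_def)
qed

text \<open>Pascal's rule, read as a split by the last step: up from \<open>i\<close> or down from
  \<open>i + 2\<close>.\<close>

lemma ballot_Suc_Suc: "ballot (Suc i) (Suc j) = ballot i (Suc j) + ballot (i + 2) j"
  by (cases j) (simp_all add: ballot_def)

text \<open>Each factor x is one step of a path. For \<open>k = 1\<close> every up-step has weight
  1, since \<open>2 - k = 1\<close>, and every down-step has weight \<open>a\<close>.\<close>

lemma dickson_coord_1_monom:
  "dickson_coord a 1 (monom 1 (i + 2 * j)) i = of_real (a ^ j * ballot i j)"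
proof (induction "i + 2 * j" arbitrary: i j)
  case 0
  then show ?case by (simp add: monom_0 dickson_coord_pCons ballot_0_right)
next
  case (Suc n)
  show ?case
  proof (cases i)
    case 0
    then obtain m where j: "j = Suc m" using Suc.hyps(2) by (cases j) auto
    have "dickson_coord a 1 (monom 1 n) 1 = of_real (a ^ m * ballot 1 m)"
      using Suc.hyps(1)[of 1 m] Suc.hyps(2) 0 j by simp
    then have "dickson_coord a 1 (monom 1 (Suc n)) i = of_real (a ^ j * ballot i j)"
      unfolding 0 j dickson_coord_monom_Suc by (simp add: ballot_0_Suc)
    then show ?thesis by (simp only: Suc.hyps(2))
  next
    case i: (Suc l)
    have "dickson_coord a 1 (monom 1 n) l = of_real (a ^ j * ballot l j)"
      using Suc.hyps(1)[of l j] Suc.hyps(2) i by simp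
    moreover have "of_real a * dickson_coord a 1 (monom 1 n) (l + 2) =
        of_real (a ^ j * (case j of 0 \<Rightarrow> 0 | Suc m \<Rightarrow> ballot (l + 2) m))"
    proof (cases j)
      \<comment> \<open>Now \<open>n = l\<close>, so index \<open>l + 2\<close> lies beyond the
        degree.\<close>
      case 0
      then show ?thesis using Suc.hyps(2) i by (simp add: dickson_coord_monom_eq_0)
    next
      case j: (Suc m)
      then show ?thesis using Suc.hyps(1)[of "l + 2" m] Suc.hyps(2) i by simp
    qed
    moreover have "dickson_coord a 1 (monom 1 (Suc n)) i =
        dickson_coord a 1 (monom 1 n) l + of_real a * dickson_coord a 1 (monom 1 n) (l + 2)"
      unfolding i dickson_coord_monom_Suc by simp
    moreover have "ballot i j = ballot l j + (case j of 0 \<Rightarrow> 0 | Suc m \<Rightarrow> ballot (l + 2) m)"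
      unfolding i by (cases j) (simp_all only: ballot_0_right ballot_Suc_Suc nat.case add_0_right)
    ultimately have "dickson_coord a 1 (monom 1 (Suc n)) i = of_real (a ^ j * ballot i j)"
      by (simp only: distrib_left of_real_add)
    then show ?thesis by (simp only: Suc.hyps(2))
  qed
qed

text \<open>Absorption gives n C(2n,n) = (n+1) C(2n,n-1), which turns the difference into a Catalan
  number.\<close>

lemma ballot_0_left: "ballot 0 n = real ((2 * n) choose n) / (n + 1)"
proof (cases n)
  case (Suc m)
  have "Suc m * ((2 * n) choose Suc m) = (2 * n - m) * ((2 * n) choose m)"
    using binomial_absorb_comp[of "2 * n" m] binomial_absorption[of m "2 * n"] by simp
  then have "real (Suc m) * real ((2 * n) choose n) = real (n + 1) * real ((2 * n) choose m)"
    unfolding Suc by (metis Suc_eq_plus1 add_Suc_right add_diff_cancel_right' mult_2 of_nat_mult add_Suc)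
  then show ?thesis by (simp add: ballot_def Suc field_simps del: binomial_Suc_Suc)
qed (simp add: ballot_def)

text \<open>Both sides start at 1 and are multiplied by 2(2n+1)/(n+2) on passing from
  \<open>n\<close> to \<open>n + 1\<close>.\<close>

lemma half_gchoose_Suc: "2 * (- 4) ^ n * ((1 / 2 :: real) gchoose Suc n) = real ((2 * n) choose n) / (n + 1)"
proof (induction n)
  case (Suc n)
  have "real (Suc n) * real ((2 * Suc n) choose Suc n) = 2 * real (Suc (2 * n)) * real ((2 * n) choose n)"
  proof -
    have "Suc n * ((2 * Suc n) choose Suc n) = (2 * Suc n) * (Suc (2 * n) choose n)"
      using Suc_times_binomial[of n "Suc (2 * n)"] by simp
    moreover have "Suc n * (Suc (2 * n) choose n) = Suc (2 * n) * ((2 * n) choose n)"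
      using binomial_absorb_comp[of "Suc (2 * n)" n] by simp
    \<comment> \<open>The extra factor \<open>Suc n\<close> lets the two absorption identities be
      chained; it is cancelled next.\<close>
    ultimately have "Suc n * (Suc n * ((2 * Suc n) choose Suc n)) = Suc n * (2 * Suc (2 * n) * ((2 * n) choose n))"
      by (metis mult.assoc mult.commute)
    then have "Suc n * ((2 * Suc n) choose Suc n) = 2 * Suc (2 * n) * ((2 * n) choose n)"
      by (simp only: mult_cancel1) simp
    then have "real (Suc n * ((2 * Suc n) choose Suc n)) = real (2 * Suc (2 * n) * ((2 * n) choose n))"
      by (simp only:)
    then show ?thesis by (simp only: of_nat_mult of_nat_numeral)
  qed
  then have c: "real ((2 * Suc n) choose Suc n) = 2 * real (Suc (2 * n)) * (real ((2 * n) choose n) / (n + 1))"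
    by (simp add: field_simps del: binomial_Suc_Suc)
  have g: "(1 / 2 :: real) gchoose Suc (Suc n) = (1 / 2 - real (Suc n)) / real (n + 2) * ((1 / 2) gchoose Suc n)"
    using gbinomial_mult_1[of "1 / 2 :: real" "Suc n"] by (simp add: field_simps)
  have "2 * (- 4) ^ Suc n * ((1 / 2 :: real) gchoose Suc (Suc n)) =
      (- 4) * (1 / 2 - real (Suc n)) / real (n + 2) * (2 * (- 4) ^ n * ((1 / 2) gchoose Suc n))"
    unfolding g by (simp add: algebra_simps)
  also have "\<dots> = real ((2 * Suc n) choose Suc n) / real (Suc n + 1)"
  proof -
    have "(- 4) * (1 / 2 - real (Suc n)) = 2 * real (Suc (2 * n))"
      by simp
    then show ?thesis unfolding Suc.IH c by (simp add: ac_simps)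
  qed
  finally show ?case by simp
qed simp

lemma dickson_coord_1_even_monom:
  "dickson_coord a 1 (monom 1 (2 * n)) 0 = of_real (2 * (- 4) ^ n * ((1 / 2) gchoose Suc n) * a ^ n)"
  using dickson_coord_1_monom[of a 0 n] by (simp only: ballot_0_left half_gchoose_Suc) simp

section \<open>Solving the recurrence for the moments\<close>

lemma moment_recurrence:
  assumes "dickson_functional a k L" "k \<noteq> 2"
  shows "of_real (k - 1) * moment L (n + 2) + of_real (a * (k - 2)\<^sup>2) * moment L n =
    of_real a * dickson_coord a 1 (monom 1 n) 0"
proof -
  have lin: "L (p + q) = L p + L q" "L (smult c p) = c * L p" for p q c
    using assms by (auto simp: dickson_functional_def linear_functional_on_def dickson_domain_def)
  have "dickson_quadratic a k * monom 1 n =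
      smult (of_real (k - 1)) (monom 1 (n + 2)) + smult (of_real (a * (k - 2)\<^sup>2)) (monom 1 n)"
    by (simp add: dickson_quadratic_def monom_Suc)
  then show ?thesis
    using dickson_functional_quadratic_mult[OF assms, of "monom 1 n"] by (simp only: lin moment_def)
qed

text \<open>At \<open>k = 1\<close> the leading coefficient \<open>k - 1\<close> vanishes, and the
  recurrence determines each moment directly after cancelling \<open>a\<close>.\<close>

lemma moment_1_even:
  assumes "a > 0" "dickson_functional a 1 L"
  shows "moment L (2 * n) = of_real (2 ^ (2 * n + 1) * ((1 / 2) gchoose (n + 1)) * (- a) ^ n)"
proof -
  have "moment L (2 * n) = of_real (2 * (- 4) ^ n * ((1 / 2) gchoose Suc n) * a ^ n)"
    using moment_recurrence[OF assms(2), of "2 * n"] assms(1)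
    unfolding dickson_coord_1_even_monom by simp
  also have "2 * (- 4) ^ n * ((1 / 2) gchoose Suc n) * a ^ n = 2 ^ (2 * n + 1) * ((1 / 2) gchoose (n + 1)) * (- a) ^ n"
    by (simp add: power_mult power_minus[of "4 :: real"] power_minus[of a])
  finally show ?thesis .
qed

text \<open>Splitting off x^2 shifts the index by one, so the value is \<open>a\<close> times the
  \<open>k = 1\<close> moment of order \<open>2 * n\<close>.\<close>

lemma moment_2_even:
  assumes "dickson_functional a 2 L"
  shows "moment L (2 * Suc n) = of_real (- (2 ^ (2 * Suc n - 1)) * ((1 / 2) gchoose Suc n) * (- a) ^ Suc n)"
proof -
  have "moment L (2 * Suc n) = L (monom 1 2 * monom 1 (2 * n))"
    by (simp add: moment_def mult_monom)
  also have "\<dots> = of_real (a * (2 * (- 4) ^ n * ((1 / 2) gchoose Suc n) * a ^ n))"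
    unfolding dickson_functional_2_mult[OF assms] dickson_coord_1_even_monom by simp
  also have "a * (2 * (- 4) ^ n * ((1 / 2) gchoose Suc n) * a ^ n) =
      - (2 ^ (2 * Suc n - 1)) * ((1 / 2) gchoose Suc n) * (- a) ^ Suc n"
    by (simp add: power_mult power_minus[of "4 :: real"] power_minus[of a])
  finally show ?thesis .
qed

text \<open>The prefactor solves the homogeneous recurrence, with ratio -a(k-2)^2/(k-1); each
  Catalan term on the right-hand side then contributes one summand.\<close>

lemma moment_even:
  assumes "dickson_functional a k L" "k \<noteq> 1" "k \<noteq> 2"
  shows "moment L (2 * n) =
    of_real (- (1 / 2) * ((k - 2) ^ (2 * n) / (k - 1) ^ (n + 1)) * (- a) ^ n *
      (k / (k - 2) + (\<Sum>j\<le>n. ((1 / 2) gchoose j) * (4 * (k - 1) / (k - 2) ^ 2) ^ j)))"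
proof (induction n)
  case 0
  have "moment L 0 = of_real (1 / (2 - k))"
  proof -
    have "dickson a k 0 = smult (of_real (2 - k)) (monom 1 0)"
      by (simp add: dickson_0 monom_0)
    moreover have "L (smult c p) = c * L p" for c p
      using assms by (simp add: dickson_functional_def linear_functional_on_def dickson_domain_def)
    ultimately have "of_real (2 - k) * moment L 0 = L (dickson a k 0)"
      by (simp only: moment_def)
    then show ?thesis
      using assms by (simp add: dickson_functional_dickson field_simps)
  qed
  \<comment> \<open>The term \<open>k / (k - 2)\<close> is exactly what makes the formula match this
    initial moment.\<close>
  also have "1 / (2 - k) = - (1 / 2) * (1 / (k - 1)) * (k / (k - 2) + 1)"
    using assms by (simp add: divide_simps)
  finally show ?case by simp
next
  case (Suc n)
  define s where "s = k / (k - 2) + (\<Sum>j\<le>n. ((1 / 2) gchoose j) * (4 * (k - 1) / (k - 2) ^ 2) ^ j)"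
  define g where "g = (1 / 2 :: real) gchoose Suc n"
  define u where "u = - (1 / 2) * ((k - 2) ^ (2 * n) / (k - 1) ^ (n + 1)) * (- a) ^ n * s"
  have "of_real (k - 1) * moment L (2 * Suc n) =
      of_real (a * (2 * (- 4) ^ n * g * a ^ n) - a * (k - 2)\<^sup>2 * u)"
    using moment_recurrence[OF assms(1,3), of "2 * n"]
    unfolding dickson_coord_1_even_monom Suc g_def u_def s_def by (simp add: algebra_simps)
  then have "moment L (2 * Suc n) = of_real ((a * (2 * (- 4) ^ n * g * a ^ n) - a * (k - 2)\<^sup>2 * u) / (k - 1))"
    using assms(2) by (simp add: field_simps)
  also have "(a * (2 * (- 4) ^ n * g * a ^ n) - a * (k - 2)\<^sup>2 * u) / (k - 1) =
      - (1 / 2) * ((k - 2) ^ (2 * Suc n) / (k - 1) ^ (Suc n + 1)) * (- a) ^ Suc n *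
        (s + g * (4 * (k - 1) / (k - 2) ^ 2) ^ Suc n)"
  proof -
    define d e where "d = k - 1" and "e = k - 2"
    have ne: "d \<noteq> 0" "e \<noteq> 0" using assms by (auto simp: d_def e_def)
    \<comment> \<open>Moving the sign onto \<open>a\<close> gives the inhomogeneous term the factor
      \<open>(- a) ^ n\<close> of the prefactor.\<close>
    have p: "(- 4) ^ n * a ^ n = 4 ^ n * (- a) ^ n"
      by (simp flip: power_mult_distrib)
    have "(a * (2 * (- 4) ^ n * g * a ^ n) - a * e\<^sup>2 * u) / d = (a * 2 * g * ((- 4) ^ n * a ^ n) - a * e\<^sup>2 * u) / d"
      by simp
    also have "\<dots> = - (1 / 2) * (e ^ (2 * Suc n) / d ^ (Suc n + 1)) * (- a) ^ Suc n * (s + g * (4 * d / e ^ 2) ^ Suc n)"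
      unfolding p u_def d_def[symmetric] e_def[symmetric] using ne
      by (simp add: power_mult_distrib power_divide power_mult divide_simps power2_eq_square)
        (simp add: algebra_simps)
    finally show ?thesis unfolding d_def e_def .
  qed
  finally show ?case by (simp only: s_def g_def sum.atMost_Suc add.assoc)
qed

theorem proposition32:
  fixes a k :: real and L :: "complex poly \<Rightarrow> complex"
  assumes "a > 0"
    and "dickson_functional a k L"
  shows "(k = 1 \<longrightarrow>
            (\<forall>n. moment L (2 * n) = of_real (2 ^ (2 * n + 1) * ((1 / 2) gchoose (n + 1)) * (- a) ^ n))) \<and>
         (k = 2 \<longrightarrow>
            (\<forall>n\<ge>1. moment L (2 * n) = of_real (- (2 ^ (2 * n - 1)) * ((1 / 2) gchoose n) * (- a) ^ n))) \<and>
         (k \<noteq> 1 \<and> k \<noteq> 2 \<longrightarrow>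
            (\<forall>n. moment L (2 * n) =
               of_real (- (1 / 2) * ((k - 2) ^ (2 * n) / (k - 1) ^ (n + 1)) * (- a) ^ n *
                 (k / (k - 2) + (\<Sum>j\<le>n. ((1 / 2) gchoose j) * (4 * (k - 1) / (k - 2) ^ 2) ^ j)))))"
proof (intro conjI impI allI)
  fix n assume "k = 1"
  with assms show "moment L (2 * n) = of_real (2 ^ (2 * n + 1) * ((1 / 2) gchoose (n + 1)) * (- a) ^ n)"
    by (simp only: moment_1_even)
next
  fix n :: nat assume "k = 2" "1 \<le> n"
  then show "moment L (2 * n) = of_real (- (2 ^ (2 * n - 1)) * ((1 / 2) gchoose n) * (- a) ^ n)"
    using assms(2) moment_2_even[of a L "n - 1"] by simp
next
  fix n assume "k \<noteq> 1 \<and> k \<noteq> 2"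
  then show "moment L (2 * n) =
      of_real (- (1 / 2) * ((k - 2) ^ (2 * n) / (k - 1) ^ (n + 1)) * (- a) ^ n *
        (k / (k - 2) + (\<Sum>j\<le>n. ((1 / 2) gchoose j) * (4 * (k - 1) / (k - 2) ^ 2) ^ j)))"
    using moment_even[OF assms(2)] by blast
qed

end
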